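(* Let $\mathcal{T}$ be a family of complete first-order theories in a common language $\Sigma$ and let $n$ be a positive natural number. Then ${\rm RS}(\mathcal{T})=2$ and ${\rm ds}(\mathcal{T})=n$ if and only if $\mathcal{T}$ is the disjoint union of subfamilies $\mathcal{T}_{\varphi_1},\ldots,\mathcal{T}_{\varphi_n}$ for some pairwise inconsistent $\Sigma$-sentences $\varphi_1,\ldots,\varphi_n$ such that each $\mathcal{T}_{\varphi_i}$ is $a$-minimal.
   Context: A family $\mathcal{T}$ is a set of complete first-order theories in a common predicate language $\Sigma$. For a $\Sigma$-sentence $\varphi$, $\mathcal{T}_\varphi=\{T\in\mathcal{T}\mid \varphi\in T\}$. Sentences are pairwise inconsistent if the conjunction of any two distinct ones has no model. An accumulation point of a family $\mathcal{F}$ is a complete $\Sigma$-theory $T$ such that $\mathcal{F}_\varphi$ is infinite for every $\varphi\in T$. A family $\mathcal{F}$ with infinitely many accumulation points is $a$-minimal if for every $\Sigma$-sentence $\varphi$, $\mathcal{F}_\varphi$ or $\mathcal{F}_{\neg\varphi}$ has only finitely many accumulation points. Rank ${\rm RS}$: ${\rm RS}(\emptyset)=-1$; ${\rm RS}(\mathcal{T})=0$ for finite nonempty $\mathcal{T}$; ${\rm RS}(\mathcal{T})\geq 1$ for infinite $\mathcal{T}$; for $\alpha=\beta+1$, ${\rm RS}(\mathcal{T})\geq\alpha$ iff there are pairwise inconsistent $\Sigma$-sentences $\varphi_n$, $n\in\omega$, with ${\rm RS}(\mathcal{T}_{\varphi_n})\geq\beta$ for all $n$; for limit $\alpha$, ${\rm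 RS}(\mathcal{T})\geq\alpha$ iff ${\rm RS}(\mathcal{T})\geq\beta$ for all $\beta<\alpha$; ${\rm RS}(\mathcal{T})=\alpha$ iff ${\rm RS}(\mathcal{T})\geq\alpha$ and not ${\rm RS}(\mathcal{T})\geq\alpha+1$. If ${\rm RS}(\mathcal{T})=\alpha\ge 0$ is an ordinal, ${\rm ds}(\mathcal{T})$ is the maximal number of pairwise inconsistent $\Sigma$-sentences $\varphi_i$ with ${\rm RS}(\mathcal{T}_{\varphi_i})=\alpha$. *)

theory Defs
  imports "HOL-Library.Disjoint_Sets"
begin

section \<open>First-order logic with equality over a predicate language\<close>

text \<open>
  A predicate language is a partial map: \<open>\<Sigma> P = Some k\<close> means that \<open>P\<close> is a \<open>k\<close>-ary predicate symbol
  of \<open>\<Sigma>\<close>.  The set of symbols may be empty or of any cardinality, and \<open>k = 0\<close> is allowed.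
  Individual variables are named by natural numbers.
\<close>

type_synonym 'p lang = "'p \<rightharpoonup> nat"

datatype 'p form =
    Eq nat nat
  | Pred 'p "nat list"
  | Neg "'p form"
  | And "'p form" "'p form"
  | Ex nat "'p form"

fun wff :: "'p lang \<Rightarrow> 'p form \<Rightarrow> bool" where
  "wff \<Sigma> (Eq x y) = True"
| "wff \<Sigma> (Pred P xs) = (\<Sigma> P = Some (length xs))"
| "wff \<Sigma> (Neg \<phi>) = wff \<Sigma> \<phi>"
| "wff \<Sigma> (And \<phi> \<psi>) = (wff \<Sigma> \<phi> \<and> wff \<Sigma> \<psi>)"
| "wff \<Sigma> (Ex x \<phi>) = wff \<Sigma> \<phi>"

fun fv :: "'p form \<Rightarrow> nat set" where
  "fv (Eq x y) = {x, y}"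
| "fv (Pred P xs) = set xs"
| "fv (Neg \<phi>) = fv \<phi>"
| "fv (And \<phi> \<psi>) = fv \<phi> \<union> fv \<psi>"
| "fv (Ex x \<phi>) = fv \<phi> - {x}"

definition sentences :: "'p lang \<Rightarrow> 'p form set" where
  "sentences \<Sigma> = {\<phi>. wff \<Sigma> \<phi> \<and> fv \<phi> = {}}"

record ('p, 'u) struct =
  univ :: "'u set"
  interp :: "'p \<Rightarrow> 'u list \<Rightarrow> bool"

fun sat :: "('p, 'u) struct \<Rightarrow> (nat \<Rightarrow> 'u) \<Rightarrow> 'p form \<Rightarrow> bool" where
  "sat M e (Eq x y) = (e x = e y)"
| "sat M e (Pred P xs) = interp M P (map e xs)"
| "sat M e (Neg \<phi>) = (\<not> sat M e \<phi>)"
| "sat M e (And \<phi> \<psi>) = (sat M e \<phi> \<and> sat M e \<psi>)"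
| "sat M e (Ex x \<phi>) = (\<exists>a\<in>univ M. sat M (e(x := a)) \<phi>)"

definition models :: "('p, 'u) struct \<Rightarrow> 'p form \<Rightarrow> bool" (infix "\<Turnstile>" 50) where
  "M \<Turnstile> \<phi> \<longleftrightarrow> (\<forall>e. range e \<subseteq> univ M \<longrightarrow> sat M e \<phi>)"

definition model_of :: "('p, 'u) struct \<Rightarrow> 'p form set \<Rightarrow> bool" where
  "model_of M \<Gamma> \<longleftrightarrow> univ M \<noteq> {} \<and> (\<forall>\<phi>\<in>\<Gamma>. M \<Turnstile> \<phi>)"

text \<open>
  HOL cannot quantify over the type of the universe inside a definition, so we let models live on
  nonempty subsets of \<open>'p + nat\<close>.  This is no restriction: by the downward Loewenheim-Skolem theorem
  (lemma \<open>has_model_if_model_of\<close> below) a set of sentences with a model over an arbitrary type also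
  has one over \<open>'p + nat\<close>.
\<close>

definition has_model :: "'p form set \<Rightarrow> bool" where
  "has_model \<Gamma> \<longleftrightarrow> (\<exists>M :: ('p, 'p + nat) struct. model_of M \<Gamma>)"

definition complete_theory :: "'p lang \<Rightarrow> 'p form set \<Rightarrow> bool" where
  "complete_theory \<Sigma> T \<longleftrightarrow>
     T \<subseteq> sentences \<Sigma> \<and> has_model T \<and> (\<forall>\<phi>\<in>sentences \<Sigma>. \<phi> \<in> T \<or> Neg \<phi> \<in> T)"


section \<open>Families of theories, rank and degree\<close>

definition subfamily :: "'p form set set \<Rightarrow> 'p form \<Rightarrow> 'p form set set" where
  "subfamily \<T> \<phi> = {T \<in> \<T>. \<phi> \<in> T}"

definition pairwise_inconsistent :: "'p lang \<Rightarrow> 'i set \<Rightarrow> ('i \<Rightarrow> 'p form) \<Rightarrow> bool" where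
  "pairwise_inconsistent \<Sigma> I \<phi> \<longleftrightarrow>
     (\<forall>i\<in>I. \<phi> i \<in> sentences \<Sigma>) \<and>
     (\<forall>i\<in>I. \<forall>j\<in>I. i \<noteq> j \<longrightarrow> \<not> has_model {And (\<phi> i) (\<phi> j)})"

definition accumulation_points :: "'p lang \<Rightarrow> 'p form set set \<Rightarrow> 'p form set set" where
  "accumulation_points \<Sigma> \<F> = {T. complete_theory \<Sigma> T \<and> (\<forall>\<phi>\<in>T. infinite (subfamily \<F> \<phi>))}"

definition a_minimal :: "'p lang \<Rightarrow> 'p form set set \<Rightarrow> bool" where
  "a_minimal \<Sigma> \<F> \<longleftrightarrow>
     infinite (accumulation_points \<Sigma> \<F>) \<and>
     (\<forall>\<phi>\<in>sentences \<Sigma>. finite (accumulation_points \<Sigma> (subfamily \<F> \<phi>)) \<or>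
                       finite (accumulation_points \<Sigma> (subfamily \<F> (Neg \<phi>))))"

text \<open>
  \<open>RS_ge \<Sigma> \<alpha> \<T>\<close> is \<open>RS(\<T>) \<ge> \<alpha>\<close> for finite ordinals \<open>\<alpha>\<close>.  The recursion for a finite \<open>\<alpha>\<close> never
  reaches a limit ordinal, and \<open>RS(\<T>) = \<alpha>\<close> refers only to the levels \<open>\<alpha>\<close> and \<open>\<alpha> + 1\<close>.
\<close>

fun RS_ge :: "'p lang \<Rightarrow> nat \<Rightarrow> 'p form set set \<Rightarrow> bool" where
  "RS_ge \<Sigma> 0 \<T> = (\<T> \<noteq> {})"
| "RS_ge \<Sigma> (Suc 0) \<T> = infinite \<T>"
| "RS_ge \<Sigma> (Suc (Suc \<beta>)) \<T> =
     (\<exists>\<phi> :: nat \<Rightarrow> 'p form. pairwise_inconsistent \<Sigma> UNIV \<phi> \<and>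
        (\<forall>k. RS_ge \<Sigma> (Suc \<beta>) (subfamily \<T> (\<phi> k))))"

definition RS_eq :: "'p lang \<Rightarrow> 'p form set set \<Rightarrow> nat \<Rightarrow> bool" where
  "RS_eq \<Sigma> \<T> \<alpha> \<longleftrightarrow> RS_ge \<Sigma> \<alpha> \<T> \<and> \<not> RS_ge \<Sigma> (Suc \<alpha>) \<T>"

text \<open>
  \<open>ds_eq \<Sigma> \<T> n\<close> says that \<open>RS(\<T>)\<close> is a finite ordinal and that \<open>ds(\<T>)\<close> exists and equals \<open>n\<close>, i.e.
  \<open>n\<close> is the largest attained number.
\<close>

definition ds_eq :: "'p lang \<Rightarrow> 'p form set set \<Rightarrow> nat \<Rightarrow> bool" where
  "ds_eq \<Sigma> \<T> n \<longleftrightarrow>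
     (\<exists>\<alpha>. RS_eq \<Sigma> \<T> \<alpha> \<and>
        (let attained = {m :: nat. \<exists>\<phi>. pairwise_inconsistent \<Sigma> {1..m} \<phi> \<and>
                                     (\<forall>i\<in>{1..m}. RS_eq \<Sigma> (subfamily \<T> (\<phi> i)) \<alpha>)}
         in n \<in> attained \<and> (\<forall>m\<in>attained. m \<le> n)))"


section \<open>Adequacy of the universe type\<close>

lemma sat_cong: "(\<And>x. x \<in> fv \<phi> \<Longrightarrow> e x = e' x) \<Longrightarrow> sat M e \<phi> = sat M e' \<phi>"
proof (induction \<phi> arbitrary: e e')
  case (Pred P xs)
  then have "map e xs = map e' xs" by simp
  then show ?case by (metis sat.simps(2))
next
  case (And \<phi> \<psi>)
  then show ?case by (metis UnCI fv.simps(4) sat.simps(4))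
next
  case (Neg \<phi>)
  then show ?case by (metis fv.simps(3) sat.simps(3))
next
  case (Ex x \<phi>)
  have "sat M (e(x := a)) \<phi> = sat M (e'(x := a)) \<phi>" for a
    using Ex.prems by (intro Ex.IH) auto
  then show ?case by simp
qed auto

lemma finite_fv: "finite (fv \<phi>)"
  by (induction \<phi>) auto

lemma ex_inj_pair: "\<exists>f :: ('p + nat) \<times> ('p + nat) \<Rightarrow> 'p + nat. inj f"
proof -
  have "infinite (UNIV :: ('p + nat) set)"
    by (simp add: finite_Plus_UNIV_iff)
  from card_of_Times_same_infinite[OF this] show ?thesis
    unfolding card_of_ordIso[symmetric] by (auto simp: bij_betw_def)
qed

definition pr :: "'p + nat \<Rightarrow> 'p + nat \<Rightarrow> 'p + nat" where
  "pr a b = (SOME f. inj f) (a, b)"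

lemma pr_inject [simp]: "pr a b = pr c d \<longleftrightarrow> a = c \<and> b = d"
  using injD[OF someI_ex[OF ex_inj_pair], of "(a, b)" "(c, d)"]
  unfolding pr_def by blast

fun enc_list :: "('p + nat) list \<Rightarrow> 'p + nat" where
  "enc_list [] = pr (Inr 0) (Inr 0)"
| "enc_list (x # xs) = pr (Inr 1) (pr x (enc_list xs))"

lemma enc_list_inject [simp]: "enc_list xs = enc_list ys \<longleftrightarrow> xs = ys"
proof (induction xs arbitrary: ys)
  case Nil
  then show ?case by (cases ys) auto
next
  case (Cons a xs)
  then show ?case by (cases ys) auto
qed

fun enc_form :: "'p form \<Rightarrow> 'p + nat" where
  "enc_form (Eq x y) = pr (Inr 0) (pr (Inr x) (Inr y))"
| "enc_form (Pred P xs) = pr (Inr 1) (pr (Inl P) (enc_list (map Inr xs)))"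
| "enc_form (Neg \<phi>) = pr (Inr 2) (enc_form \<phi>)"
| "enc_form (And \<phi> \<psi>) = pr (Inr 3) (pr (enc_form \<phi>) (enc_form \<psi>))"
| "enc_form (Ex x \<phi>) = pr (Inr 4) (pr (Inr x) (enc_form \<phi>))"

lemma enc_form_inject [simp]: "enc_form \<phi> = enc_form \<psi> \<longleftrightarrow> \<phi> = \<psi>"
proof (induction \<phi> arbitrary: \<psi>)
  case (Eq x y) then show ?case by (cases \<psi>) auto
next
  case (Pred P xs) then show ?case by (cases \<psi>) (auto simp: inj_map_eq_map)
next
  case (Neg \<phi>) then show ?case by (cases \<psi>) auto
next
  case (And \<phi>1 \<phi>2) then show ?case by (cases \<psi>) auto
next
  case (Ex x \<phi>) then show ?case by (cases \<psi>) auto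
qed

datatype 'p skolem = Sk "'p form" nat "'p skolem list"

fun enc_skolem :: "'p skolem \<Rightarrow> 'p + nat" where
  "enc_skolem (Sk \<phi> x ts) = pr (enc_form \<phi>) (pr (Inr x) (enc_list (map enc_skolem ts)))"

lemma enc_skolem_inject: "enc_skolem s = enc_skolem t \<Longrightarrow> s = t"
proof (induction s arbitrary: t)
  case (Sk \<phi> x ts)
  obtain \<psi> y us where t: "t = Sk \<psi> y us" by (cases t)
  have eq: "\<phi> = \<psi>" "x = y" "map enc_skolem ts = map enc_skolem us"
    using Sk.prems by (simp_all add: t)
  have "list_all2 (=) ts us"
    using eq(3) Sk.IH
    by (auto simp: list_all2_conv_all_nth list_eq_iff_nth_eq)
  then show ?case by (simp add: t eq list.rel_eq)
qed

definition env :: "'u \<Rightarrow> 'u list \<Rightarrow> nat \<Rightarrow> 'u" where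
  "env a us = (\<lambda>i. if i < length us then us ! i else a)"

definition wit :: "('p, 'u) struct \<Rightarrow> 'u \<Rightarrow> 'p form \<Rightarrow> nat \<Rightarrow> (nat \<Rightarrow> 'u) \<Rightarrow> 'u" where
  "wit M a \<phi> x e = (if \<exists>b\<in>univ M. sat M (e(x := b)) \<phi>
                    then SOME b. b \<in> univ M \<and> sat M (e(x := b)) \<phi> else a)"

fun eval_sk :: "('p, 'u) struct \<Rightarrow> 'u \<Rightarrow> 'p skolem \<Rightarrow> 'u" where
  "eval_sk M a (Sk \<phi> x ts) = wit M a \<phi> x (env a (map (eval_sk M a) ts))"

lemma wit_props:
  assumes "a \<in> univ M"
  shows "wit M a \<phi> x e \<in> univ M"
    and "\<exists>b\<in>univ M. sat M (e(x := b)) \<phi> \<Longrightarrow> sat M (e(x := wit M a \<phi> x e)) \<phi>"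
proof -
  have *: "(SOME b. b \<in> univ M \<and> sat M (e(x := b)) \<phi>) \<in> univ M \<and>
        sat M (e(x := (SOME b. b \<in> univ M \<and> sat M (e(x := b)) \<phi>))) \<phi>"
    if "\<exists>b\<in>univ M. sat M (e(x := b)) \<phi>"
    by (rule someI_ex) (use that in blast)
  then show "wit M a \<phi> x e \<in> univ M"
    using assms by (simp add: wit_def)
  show "sat M (e(x := wit M a \<phi> x e)) \<phi>" if "\<exists>b\<in>univ M. sat M (e(x := b)) \<phi>"
    using * that by (simp add: wit_def)
qed

lemma downward_Loewenheim_Skolem:
  fixes M :: "('p, 'u) struct"
  assumes "univ M \<noteq> {}"
  shows "\<exists>N :: ('p, 'p + nat) struct. univ N \<noteq> {} \<and>
           (\<forall>\<phi>. fv \<phi> = {} \<longrightarrow> (N \<Turnstile> \<phi> \<longleftrightarrow> M \<Turnstile> \<phi>))"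
proof -
  obtain a where a: "a \<in> univ M" using assms by blast
  define h where "h = eval_sk M a"
  define H where "H = range h"
  define g :: "'u \<Rightarrow> 'p + nat" where "g u = enc_skolem (inv h u)" for u
  define k where "k = inv_into H g"
  define N where
    "N = \<lparr>univ = g ` H, interp = (\<lambda>P us. interp M P (map k us))\<rparr>"
  have inj: "inj_on g H"
    unfolding g_def H_def by (rule inj_onI) (metis enc_skolem_inject f_inv_into_f)
  then have kg: "k (g u) = u" if "u \<in> H" for u
    using that by (simp add: k_def)
  have HM: "H \<subseteq> univ M"
  proof -
    have "h t \<in> univ M" for t
      unfolding h_def by (cases t) (simp add: wit_props(1)[OF a])
    then show ?thesis by (auto simp: H_def)
  qed
  have closed: "\<exists>b\<in>H. sat M (e(x := b)) \<phi>"
    if e: "range e \<subseteq> H" and ex: "\<exists>b\<in>univ M. sat M (e(x := b)) \<phi>" for e x \<phi>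
  proof -
    obtain m where m: "\<forall>i\<in>fv \<phi>. i < m"
      using finite_fv[of \<phi>] by (metis finite_nat_set_iff_bounded)
    define ts where "ts = map (\<lambda>i. inv h (e i)) [0..<m]"
    define d where "d = env a (map h ts)"
    have d: "d i = e i" if "i < m" for i
      using that e by (simp add: d_def env_def ts_def H_def f_inv_into_f image_subset_iff)
    have sat_d: "sat M (d(x := b)) \<phi> = sat M (e(x := b)) \<phi>" for b
      by (rule sat_cong) (use m d in auto)
    have "h (Sk \<phi> x ts) = wit M a \<phi> x d"
      by (simp add: h_def d_def)
    then have "wit M a \<phi> x d \<in> H"
      unfolding H_def by (metis rangeI)
    moreover have "sat M (d(x := wit M a \<phi> x d)) \<phi>"
      by (rule wit_props(2)[OF a]) (use ex sat_d in blast)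
    ultimately show ?thesis using sat_d by blast
  qed
  have main: "sat N e \<phi> = sat M (k \<circ> e) \<phi>" if "range e \<subseteq> g ` H" for e \<phi>
    using that
  proof (induction \<phi> arbitrary: e)
    case (Eq x y)
    have "e x \<in> g ` H" "e y \<in> g ` H" using Eq by auto
    then have "k (e x) = k (e y) \<longleftrightarrow> e x = e y" using kg by auto
    then show ?case by simp
  next
    case (Pred P xs)
    then show ?case by (simp add: N_def comp_def)
  next
    case (Ex x \<phi>)
    have ke: "range (k \<circ> e) \<subseteq> H" using Ex.prems kg by fastforce
    have step: "sat N (e(x := g b)) \<phi> = sat M ((k \<circ> e)(x := b)) \<phi>" if "b \<in> H" for b
    proof -
      have "range (e(x := g b)) \<subseteq> g ` H" using Ex.prems that by auto
      moreover have "k \<circ> e(x := g b) = (k \<circ> e)(x := b)" using kg[OF that] by auto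
      ultimately show ?thesis using Ex.IH by metis
    qed
    have "sat N e (Ex x \<phi>) = (\<exists>b\<in>H. sat M ((k \<circ> e)(x := b)) \<phi>)"
      using step by (auto simp: N_def)
    also have "\<dots> = sat M (k \<circ> e) (Ex x \<phi>)"
      using closed[OF ke] HM by auto
    finally show ?case .
  qed auto
  have aH: "\<exists>c. c \<in> H" by (auto simp: H_def)
  then obtain c where c: "c \<in> H" by blast
  have "N \<Turnstile> \<phi> \<longleftrightarrow> M \<Turnstile> \<phi>" if \<phi>: "fv \<phi> = {}" for \<phi>
  proof -
    have N: "N \<Turnstile> \<phi> \<longleftrightarrow> sat N (\<lambda>_. g c) \<phi>"
      unfolding models_def
      using sat_cong[of \<phi> _ "\<lambda>_. g c" N] \<phi> c by (auto simp: N_def)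
    have M: "M \<Turnstile> \<phi> \<longleftrightarrow> sat M (\<lambda>_. c) \<phi>"
      unfolding models_def
      using sat_cong[of \<phi> _ "\<lambda>_. c" M] \<phi> c HM by auto
    have "sat N (\<lambda>_. g c) \<phi> = sat M (k \<circ> (\<lambda>_. g c)) \<phi>"
      by (rule main) (use c in auto)
    then show ?thesis using N M kg[OF c] by (simp add: comp_def)
  qed
  moreover have "univ N \<noteq> {}" using c by (auto simp: N_def)
  ultimately show ?thesis by blast
qed

lemma has_model_if_model_of:
  fixes M :: "('p, 'u) struct"
  assumes "model_of M \<Gamma>" and "\<forall>\<phi>\<in>\<Gamma>. fv \<phi> = {}"
  shows "has_model \<Gamma>"
  using assms downward_Loewenheim_Skolem[of M]
  unfolding has_model_def model_of_def by metis

end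

theory Submission
  imports Defs
begin

text \<open>
  Complete theories form a compact space whose basic clopen sets are given by sentences, and the
  accumulation points of a family are its derived set.  Compactness (an ultraproduct) gives every
  infinite family an accumulation point, and passing to the derived set commutes with cutting by a
  sentence.  Hence \<open>RS(\<T>) \<ge> 2\<close> iff the derived set \<open>A\<close> is infinite, and both rank and degree
  count pairwise disjoint clopen sets meeting \<open>A\<close> in infinite sets; \<open>a\<close>-minimal pieces are those
  whose share of \<open>A\<close> cannot be cut into two infinite parts.
\<close>

section \<open>Ultraproducts and compactness\<close>

text \<open>Zorn yields a maximal system of sets whose finite intersections all meet
  \<open>F\<close> in an infinite set; maximality makes it an ultrafilter. It lives on the whole
  type, but each member meets \<open>F\<close> infinitely often.\<close>

lemma ex_free_ultrafilter:
  fixes F :: "'a set"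
  assumes "infinite F"
  obtains U :: "'a set set" where
    "\<And>A. - A \<in> U \<longleftrightarrow> A \<notin> U"
    "\<And>A B. A \<in> U \<Longrightarrow> B \<in> U \<Longrightarrow> A \<inter> B \<in> U"
    "\<And>A B. A \<in> U \<Longrightarrow> A \<subseteq> B \<Longrightarrow> B \<in> U"
    "\<And>A. A \<in> U \<Longrightarrow> infinite (F \<inter> A)"
proof -
  define P where "P = {C :: 'a set set. \<forall>G. finite G \<longrightarrow> G \<subseteq> C \<longrightarrow> infinite (F \<inter> \<Inter>G)}"
  have "\<exists>U\<in>P. \<forall>X\<in>P. U \<subseteq> X \<longrightarrow> X = U"
  proof (rule subset_Zorn_nonempty)
    have "{} \<in> P" using assms by (simp add: P_def)
    then show "P \<noteq> {}" by blast
  next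
    fix \<C> assume \<C>: "\<C> \<noteq> {}" "subset.chain P \<C>"
    show "\<Union>\<C> \<in> P"
      unfolding P_def
    proof (intro CollectI allI impI)
      fix G assume "finite G" "G \<subseteq> \<Union>\<C>"
      then obtain C where "C \<in> \<C>" "G \<subseteq> C"
        using finite_subset_Union_chain[OF _ _ \<C>] by blast
      then show "infinite (F \<inter> \<Inter>G)"
        using \<C>(2) \<open>finite G\<close> by (auto simp: P_def subset_chain_def)
    qed
  qed
  then obtain U where U: "U \<in> P" and max: "\<And>X. X \<in> P \<Longrightarrow> U \<subseteq> X \<Longrightarrow> X = U" by blast
  have fin: "infinite (F \<inter> \<Inter>G)" if "finite G" "G \<subseteq> U" for G
    using U that by (auto simp: P_def)
  \<comment> \<open>By maximality \<open>insert A U\<close> has a finite subsystem meeting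
    \<open>F\<close> finitely; removing \<open>A\<close> from it leaves a subset of
    \<open>U\<close>.\<close>
  have notin: "\<exists>G. finite G \<and> G \<subseteq> U \<and> finite (F \<inter> \<Inter>G \<inter> A)" if "A \<notin> U" for A
  proof -
    have "insert A U \<notin> P" using max[of "insert A U"] that by blast
    then obtain G where G: "finite G" "G \<subseteq> insert A U" "finite (F \<inter> \<Inter>G)"
      by (auto simp: P_def)
    have "finite (F \<inter> \<Inter>(G - {A}) \<inter> A)"
      by (rule finite_subset[OF _ G(3)]) blast
    then show ?thesis using G by (intro exI[of _ "G - {A}"]) auto
  qed
  \<comment> \<open>One closure property covers intersections and supersets; it is used for
    \<open>{A, B}\<close> and for \<open>{A}\<close>.\<close>
  have inter: "A \<in> U" if "finite H" "H \<subseteq> U" "\<Inter>H \<subseteq> A" for H A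
  proof (rule ccontr)
    assume "A \<notin> U"
    then obtain G where G: "finite G" "G \<subseteq> U" "finite (F \<inter> \<Inter>G \<inter> A)" using notin by blast
    have "finite (F \<inter> \<Inter>(G \<union> H))"
      by (rule finite_subset[OF _ G(3)]) (use that in blast)
    then show False using fin[of "G \<union> H"] G that by blast
  qed
  show ?thesis
  proof (rule that[of U])
    fix A B :: "'a set"
    show "- A \<in> U \<longleftrightarrow> A \<notin> U"
    proof
      assume "- A \<in> U"
      then show "A \<notin> U" using fin[of "{A, - A}"] by auto
    next
      assume "A \<notin> U"
      show "- A \<in> U"
      proof (rule ccontr)
        assume "- A \<notin> U"
        obtain G where G: "finite G" "G \<subseteq> U" "finite (F \<inter> \<Inter>G \<inter> A)"
          using notin[OF \<open>A \<notin> U\<close>] by blast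
        obtain H where H: "finite H" "H \<subseteq> U" "finite (F \<inter> \<Inter>H \<inter> - A)"
          using notin[OF \<open>- A \<notin> U\<close>] by blast
        have "finite (F \<inter> \<Inter>(G \<union> H))"
          by (rule finite_subset[of _ "(F \<inter> \<Inter>G \<inter> A) \<union> (F \<inter> \<Inter>H \<inter> - A)"]) (use G H in auto)
        then show False using fin[of "G \<union> H"] G H by blast
      qed
    qed
    show "A \<inter> B \<in> U" if "A \<in> U" "B \<in> U" using inter[of "{A, B}"] that by auto
    show "B \<in> U" if "A \<in> U" "A \<subseteq> B" using inter[of "{A}"] that by auto
    show "infinite (F \<inter> A)" if "A \<in> U" using fin[of "{A}"] that by auto
  qed
qed

text \<open>
  Equality is interpreted as identity, so the universe of the ultraproduct consists of one chosen
  representative \<open>c f\<close> of each class of functions modulo the ultrafilter.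
\<close>

lemma ultraproduct:
  fixes M :: "'i \<Rightarrow> ('p, 'u) struct" and U :: "'i set set"
  assumes compl: "\<And>A. - A \<in> U \<longleftrightarrow> A \<notin> U"
    and inter: "\<And>A B. A \<in> U \<Longrightarrow> B \<in> U \<Longrightarrow> A \<inter> B \<in> U"
    and up: "\<And>A B. A \<in> U \<Longrightarrow> A \<subseteq> B \<Longrightarrow> B \<in> U"
    and ne: "\<And>i. univ (M i) \<noteq> {}"
  shows "\<exists>N :: ('p, 'i \<Rightarrow> 'u) struct. univ N \<noteq> {} \<and>
           (\<forall>\<phi>. fv \<phi> = {} \<longrightarrow> (N \<Turnstile> \<phi> \<longleftrightarrow> {i. M i \<Turnstile> \<phi>} \<in> U))"
proof -
  \<comment> \<open>If \<open>UNIV\<close> were missing, its complement \<open>{}\<close> would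
    belong to \<open>U\<close>, and then so would the superset \<open>UNIV\<close>.\<close>
  have UNIV: "UNIV \<in> U" using compl[of UNIV] up[of "{}" UNIV] by auto
  define D where "D = {f. \<forall>i. f i \<in> univ (M i)}"
  define E where "E f g \<longleftrightarrow> {i. f i = g i} \<in> U" for f g :: "'i \<Rightarrow> 'u"
  have E_refl: "E f f" for f using UNIV by (simp add: E_def)
  have E_sym: "E f g \<Longrightarrow> E g f" for f g by (simp add: E_def eq_commute)
  have E_trans: "E f g \<Longrightarrow> E g h \<Longrightarrow> E f h" for f g h
    unfolding E_def by (erule (1) up[OF inter]) auto
  define c where "c f = (SOME g. g \<in> D \<and> E g f)" for f
  have c: "c f \<in> D" "E (c f) f" if "f \<in> D" for f
  proof -
    have "c f \<in> D \<and> E (c f) f"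
      unfolding c_def by (rule someI[of _ f]) (use that E_refl in blast)
    then show "c f \<in> D" "E (c f) f" by auto
  qed
  have c_eq: "c f = c g" if "E f g" for f g
  \<comment> \<open>Equivalent functions have the same candidates for a representative, so both
    choices use the same predicate.\<close>
  proof -
    have "E h f \<longleftrightarrow> E h g" for h using that E_sym E_trans by blast
    then show ?thesis by (simp add: c_def)
  qed
  define N :: "('p, 'i \<Rightarrow> 'u) struct" where
    "N = \<lparr>univ = c ` D, interp = (\<lambda>P fs. {i. interp (M i) P (map (\<lambda>f. f i) fs)} \<in> U)\<rparr>"
  have main: "sat N e \<phi> \<longleftrightarrow> {i. sat (M i) (\<lambda>x. e x i) \<phi>} \<in> U" if "range e \<subseteq> c ` D" for e \<phi>
    using that
  proof (induction \<phi> arbitrary: e)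
    case (Eq x y)
    obtain f g where fg: "f \<in> D" "g \<in> D" "e x = c f" "e y = c g" using Eq by blast
    have "e x = e y \<longleftrightarrow> E (e x) (e y)"
      using fg c c_eq E_refl E_sym E_trans by metis
    then show ?case by (simp add: E_def)
  next
    case (Pred P xs)
    then show ?case by (simp add: N_def comp_def)
  next
    case (Neg \<phi>)
    have "{i. \<not> sat (M i) (\<lambda>x. e x i) \<phi>} = - {i. sat (M i) (\<lambda>x. e x i) \<phi>}" by blast
    then show ?case using Neg compl by simp
  next
    case (And \<phi> \<psi>)
    have "{i. sat (M i) (\<lambda>x. e x i) \<phi> \<and> sat (M i) (\<lambda>x. e x i) \<psi>} =
      {i. sat (M i) (\<lambda>x. e x i) \<phi>} \<inter> {i. sat (M i) (\<lambda>x. e x i) \<psi>}" by blast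
    moreover have "A \<inter> B \<in> U \<longleftrightarrow> A \<in> U \<and> B \<in> U" for A B
      using inter up[of "A \<inter> B"] by blast
    ultimately show ?case using And by simp
  next
    case (Ex x \<phi>)
    have upd: "(\<lambda>y. (e(x := a)) y i) = (\<lambda>y. e y i)(x := a i)" for a i by auto
    have IH: "sat N (e(x := a)) \<phi> \<longleftrightarrow> {i. sat (M i) ((\<lambda>y. e y i)(x := a i)) \<phi>} \<in> U"
      if "a \<in> c ` D" for a
    proof -
      have "range (e(x := a)) \<subseteq> c ` D" using Ex.prems that by auto
      from Ex.IH[OF this] show ?thesis unfolding upd .
    qed
    show ?case
    proof
      assume "sat N e (Ex x \<phi>)"
      then obtain a where a: "a \<in> c ` D" "sat N (e(x := a)) \<phi>" by (auto simp: N_def)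
      have "a \<in> D" using a(1) c by blast
      show "{i. sat (M i) (\<lambda>x. e x i) (Ex x \<phi>)} \<in> U"
        by (rule up[OF a(2)[unfolded IH[OF a(1)]]]) (use \<open>a \<in> D\<close> in \<open>auto simp: D_def\<close>)
    next
      assume X: "{i. sat (M i) (\<lambda>x. e x i) (Ex x \<phi>)} \<in> U"
      \<comment> \<open>\<open>g i\<close> is a witness where \<open>M i\<close> has one and an
        arbitrary element elsewhere, which keeps \<open>g\<close> in \<open>D\<close>.\<close>
      define g where "g i = (SOME b. b \<in> univ (M i) \<and>
        ((\<exists>a\<in>univ (M i). sat (M i) ((\<lambda>y. e y i)(x := a)) \<phi>) \<longrightarrow>
          sat (M i) ((\<lambda>y. e y i)(x := b)) \<phi>))" for i
      have g: "g i \<in> univ (M i) \<and>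
        ((\<exists>a\<in>univ (M i). sat (M i) ((\<lambda>y. e y i)(x := a)) \<phi>) \<longrightarrow>
          sat (M i) ((\<lambda>y. e y i)(x := g i)) \<phi>)" for i
        unfolding g_def by (rule someI_ex) (use ne[of i] in blast)
      then have gD: "g \<in> D" by (simp add: D_def)
      \<comment> \<open>The universe contains representatives only, so \<open>g\<close> is traded
        for \<open>c g\<close>, which agrees with it on a set in \<open>U\<close>.\<close>
      have "{i. c g i = g i} \<in> U" using c(2)[OF gD] by (simp add: E_def)
      from inter[OF this X] have "{i. sat (M i) ((\<lambda>y. e y i)(x := c g i)) \<phi>} \<in> U"
        by (rule up) (use g in fastforce)
      then have "sat N (e(x := c g)) \<phi>" using IH gD by blast
      then show "sat N e (Ex x \<phi>)" using gD by (auto simp: N_def)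
    qed
  qed
  have "D \<noteq> {}"
  proof -
    have "(\<lambda>i. SOME a. a \<in> univ (M i)) \<in> D" using ne by (simp add: D_def some_in_eq)
    then show ?thesis by blast
  qed
  then obtain f where f: "f \<in> D" by blast
  have "N \<Turnstile> \<phi> \<longleftrightarrow> {i. M i \<Turnstile> \<phi>} \<in> U" if \<phi>: "fv \<phi> = {}" for \<phi>
  proof -
    have "N \<Turnstile> \<phi> \<longleftrightarrow> sat N (\<lambda>_. c f) \<phi>"
      unfolding models_def using sat_cong[of \<phi> _ "\<lambda>_. c f" N] \<phi> f by (auto simp: N_def)
    also have "\<dots> \<longleftrightarrow> {i. sat (M i) (\<lambda>x. c f i) \<phi>} \<in> U"
      by (rule main) (use f in auto)
    also have "{i. sat (M i) (\<lambda>x. c f i) \<phi>} = {i. M i \<Turnstile> \<phi>}"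
    proof -
      have "M i \<Turnstile> \<phi> \<longleftrightarrow> sat (M i) (\<lambda>x. c f i) \<phi>" for i
        unfolding models_def
        using sat_cong[of \<phi> _ "\<lambda>_. c f i" "M i"] \<phi> c(1)[OF f] by (auto simp: D_def)
      then show ?thesis by blast
    qed
    finally show ?thesis .
  qed
  moreover have "univ N \<noteq> {}" using f by (auto simp: N_def)
  ultimately show ?thesis by blast
qed


section \<open>Sentences and complete theories\<close>

lemma sentences_iff [simp]:
  "Neg \<phi> \<in> sentences \<Sigma> \<longleftrightarrow> \<phi> \<in> sentences \<Sigma>"
  "And \<phi> \<psi> \<in> sentences \<Sigma> \<longleftrightarrow> \<phi> \<in> sentences \<Sigma> \<and> \<psi> \<in> sentences \<Sigma>"
  by (auto simp: sentences_def)

text \<open>Truth in a structure quantifies over all assignments; the value of a sentence is the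
  same at each of them, and a nonempty universe guarantees that there is one.\<close>

lemma models_Neg:
  assumes "univ M \<noteq> {}" and "\<phi> \<in> sentences \<Sigma>"
  shows "M \<Turnstile> Neg \<phi> \<longleftrightarrow> \<not> M \<Turnstile> \<phi>"
proof -
  obtain a where a: "a \<in> univ M" using assms(1) by blast
  have "range e \<subseteq> univ M \<Longrightarrow> sat M e \<phi> = sat M (\<lambda>_. a) \<phi>" for e
    by (rule sat_cong) (use assms(2) in \<open>auto simp: sentences_def\<close>)
  moreover have "range (\<lambda>_::nat. a) \<subseteq> univ M" using a by auto
  ultimately show ?thesis unfolding models_def by (metis sat.simps(3))
qed

lemma models_And: "M \<Turnstile> And \<phi> \<psi> \<longleftrightarrow> M \<Turnstile> \<phi> \<and> M \<Turnstile> \<psi>"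
  by (auto simp: models_def)

text \<open>Serves as the empty conjunction and as a guaranteed member of every complete
  theory.\<close>

lemma ex_true_sentence:
  "\<exists>\<phi>\<in>sentences \<Sigma>. \<forall>M :: ('p, 'u) struct. univ M \<noteq> {} \<longrightarrow> M \<Turnstile> (\<phi> :: 'p form)"
  by (rule bexI[of _ "Ex 0 (Eq 0 0)"]) (auto simp: sentences_def models_def)

text \<open>By induction on \<open>J\<close>, conjoining one negation at a time. The result stands
  for the complement of a finite disjunction.\<close>

lemma ex_conj_neg_sentence:
  fixes \<phi> :: "'j \<Rightarrow> 'p form"
  assumes "finite J" and "\<forall>j\<in>J. \<phi> j \<in> sentences \<Sigma>"
  shows "\<exists>\<chi>\<in>sentences \<Sigma>. \<forall>M :: ('p, 'u) struct. univ M \<noteq> {} \<longrightarrow>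
           (M \<Turnstile> \<chi> \<longleftrightarrow> (\<forall>j\<in>J. \<not> M \<Turnstile> \<phi> j))"
  using assms
proof (induction J rule: finite_induct)
  case empty
  then show ?case using ex_true_sentence[of \<Sigma>] by auto
next
  case (insert j J)
  then obtain \<chi> where "\<chi> \<in> sentences \<Sigma>" "\<forall>M :: ('p, 'u) struct. univ M \<noteq> {} \<longrightarrow>
           (M \<Turnstile> \<chi> \<longleftrightarrow> (\<forall>j\<in>J. \<not> M \<Turnstile> \<phi> j))" by auto
  then show ?case using insert.prems
    by (intro bexI[of _ "And (Neg (\<phi> j)) \<chi>"]) (simp_all add: models_And models_Neg[of _ _ \<Sigma>])
qed

lemma pairwise_inconsistent_iff:
  fixes \<phi> :: "'i \<Rightarrow> 'p form"
  shows "pairwise_inconsistent \<Sigma> I \<phi> \<longleftrightarrow> (\<forall>i\<in>I. \<phi> i \<in> sentences \<Sigma>) \<and>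
    (\<forall>i\<in>I. \<forall>j\<in>I. i \<noteq> j \<longrightarrow>
      (\<forall>M :: ('p, 'p + nat) struct. univ M \<noteq> {} \<longrightarrow> \<not> (M \<Turnstile> \<phi> i \<and> M \<Turnstile> \<phi> j)))"
proof -
  have "\<not> has_model {And \<phi>1 \<phi>2} \<longleftrightarrow>
      (\<forall>M :: ('p, 'p + nat) struct. univ M \<noteq> {} \<longrightarrow> \<not> (M \<Turnstile> \<phi>1 \<and> M \<Turnstile> \<phi>2))" for \<phi>1 \<phi>2 :: "'p form"
    unfolding has_model_def model_of_def ball_simps models_And by blast
  then show ?thesis unfolding pairwise_inconsistent_def by presburger
qed

text \<open>Completeness makes \<open>T\<close> the set of sentences true in a model of it, so its
  behaviour under connectives can be read off from truth.\<close>

lemma complete_theory_model: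
  fixes T :: "'p form set"
  assumes "complete_theory \<Sigma> T"
  obtains M :: "('p, 'p + nat) struct" where "univ M \<noteq> {}"
    and "\<And>\<phi>. \<phi> \<in> sentences \<Sigma> \<Longrightarrow> \<phi> \<in> T \<longleftrightarrow> M \<Turnstile> \<phi>"
proof -
  obtain M :: "('p, 'p + nat) struct" where M: "model_of M T"
    using assms by (auto simp: complete_theory_def has_model_def)
  show ?thesis
  proof (rule that)
    show ne: "univ M \<noteq> {}" using M by (simp add: model_of_def)
    fix \<phi> assume \<phi>: "\<phi> \<in> sentences \<Sigma>"
    then have "\<phi> \<in> T \<or> Neg \<phi> \<in> T" using assms by (simp add: complete_theory_def)
    then show "\<phi> \<in> T \<longleftrightarrow> M \<Turnstile> \<phi>"
      using M models_Neg[OF ne \<phi>] by (auto simp: model_of_def)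
  qed
qed

lemma complete_theory_subset: "complete_theory \<Sigma> T \<Longrightarrow> T \<subseteq> sentences \<Sigma>"
  by (simp add: complete_theory_def)

lemma complete_theory_Neg:
  assumes "complete_theory \<Sigma> T" and "\<phi> \<in> sentences \<Sigma>"
  shows "Neg \<phi> \<in> T \<longleftrightarrow> \<phi> \<notin> T"
  using complete_theory_model[OF assms(1)] assms(2) by (metis models_Neg sentences_iff(1))

lemma complete_theory_And:
  assumes "complete_theory \<Sigma> T"
  shows "And \<phi> \<psi> \<in> T \<longleftrightarrow> \<phi> \<in> T \<and> \<psi> \<in> T"
proof (cases "\<phi> \<in> sentences \<Sigma> \<and> \<psi> \<in> sentences \<Sigma>")
  case True
  obtain M :: "('a, 'a + nat) struct" where
    "\<And>\<phi>. \<phi> \<in> sentences \<Sigma> \<Longrightarrow> \<phi> \<in> T \<longleftrightarrow> M \<Turnstile> \<phi>"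
    using complete_theory_model[OF assms] by blast
  then show ?thesis using True by (simp add: models_And)
next
  \<comment> \<open>Members of \<open>T\<close> are sentences, so neither side holds here.\<close>
  case False
  then show ?thesis using complete_theory_subset[OF assms] by (metis sentences_iff(2) subsetD)
qed

text \<open>A model of \<open>T\<close> would satisfy both sentences. In the space of theories,
  inconsistent sentences thus cut out disjoint clopen sets.\<close>

lemma complete_theory_inconsistent:
  assumes "pairwise_inconsistent \<Sigma> I \<phi>" and "complete_theory \<Sigma> T"
    and "i \<in> I" "j \<in> I" "\<phi> i \<in> T" "\<phi> j \<in> T"
  shows "i = j"
proof -
  obtain M :: "('a, 'a + nat) struct" where M: "univ M \<noteq> {}"
    "\<And>\<phi>. \<phi> \<in> sentences \<Sigma> \<Longrightarrow> \<phi> \<in> T \<longleftrightarrow> M \<Turnstile> \<phi>"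
    using complete_theory_model[OF assms(2)] by blast
  have "M \<Turnstile> \<phi> i" "M \<Turnstile> \<phi> j" using M(2) assms by (auto simp: pairwise_inconsistent_iff)
  then show ?thesis using assms(1,3,4) M(1) unfolding pairwise_inconsistent_iff by blast
qed


section \<open>Accumulation points\<close>

lemma subfamily_subset: "subfamily \<F> \<phi> \<subseteq> \<F>"
  by (auto simp: subfamily_def)

lemma subfamily_mono: "\<F> \<subseteq> \<G> \<Longrightarrow> subfamily \<F> \<phi> \<subseteq> subfamily \<G> \<phi>"
  by (auto simp: subfamily_def)

lemma subfamily_And:
  assumes "\<forall>T\<in>\<F>. complete_theory \<Sigma> T"
  shows "subfamily \<F> (And \<phi> \<psi>) = subfamily (subfamily \<F> \<phi>) \<psi>"
  using assms by (auto simp: subfamily_def complete_theory_And[of \<Sigma>])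

lemma accumulation_points_complete: "\<forall>T\<in>accumulation_points \<Sigma> \<F>. complete_theory \<Sigma> T"
  by (simp add: accumulation_points_def)

lemma accumulation_points_mono:
  "\<F> \<subseteq> \<G> \<Longrightarrow> accumulation_points \<Sigma> \<F> \<subseteq> accumulation_points \<Sigma> \<G>"
  unfolding accumulation_points_def by (auto dest: subfamily_mono finite_subset)

text \<open>Forward: an accumulation point containing \<open>Neg \<phi>\<close> would need
  infinitely many members in a trace that is empty. Backward: if \<phi> and \<psi> lie in
  \<open>T\<close>, so does their conjunction, whose trace on \<F> is the trace of \<psi> on the
  subfamily.\<close>

lemma accumulation_points_subfamily:
  assumes "\<forall>T\<in>\<F>. complete_theory \<Sigma> T" and \<phi>: "\<phi> \<in> sentences \<Sigma>"
  shows "accumulation_points \<Sigma> (subfamily \<F> \<phi>) = subfamily (accumulation_points \<Sigma> \<F>) \<phi>"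
proof (intro equalityI subsetI)
  fix T assume T: "T \<in> accumulation_points \<Sigma> (subfamily \<F> \<phi>)"
  have "subfamily (subfamily \<F> \<phi>) (Neg \<phi>) = {}"
    using assms by (auto simp: subfamily_def complete_theory_Neg[of \<Sigma>])
  then have "Neg \<phi> \<notin> T" using T by (auto simp: accumulation_points_def)
  then have "\<phi> \<in> T" using T \<phi> complete_theory_Neg by (auto simp: accumulation_points_def)
  then show "T \<in> subfamily (accumulation_points \<Sigma> \<F>) \<phi>"
    using T accumulation_points_mono[OF subfamily_subset] by (auto simp: subfamily_def)
next
  fix T assume "T \<in> subfamily (accumulation_points \<Sigma> \<F>) \<phi>"
  then show "T \<in> accumulation_points \<Sigma> (subfamily \<F> \<phi>)"
    using subfamily_And[OF assms(1)]
    by (auto simp: accumulation_points_def subfamily_def[of "Collect _"] complete_theory_And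
        simp flip: subfamily_And[OF assms(1)])
qed

text \<open>A theory at which neither family accumulates contains for each family a sentence with
  finite trace; the conjunction of the two has finite trace on the union.\<close>

lemma accumulation_points_Un:
  assumes "\<forall>T\<in>\<F> \<union> \<G>. complete_theory \<Sigma> T"
  shows "accumulation_points \<Sigma> (\<F> \<union> \<G>) = accumulation_points \<Sigma> \<F> \<union> accumulation_points \<Sigma> \<G>"
proof
  show "accumulation_points \<Sigma> (\<F> \<union> \<G>) \<subseteq> accumulation_points \<Sigma> \<F> \<union> accumulation_points \<Sigma> \<G>"
  proof (rule subsetI, rule ccontr)
    fix T assume T: "T \<in> accumulation_points \<Sigma> (\<F> \<union> \<G>)"
      and "T \<notin> accumulation_points \<Sigma> \<F> \<union> accumulation_points \<Sigma> \<G>"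
    then obtain \<phi> \<psi> where *: "\<phi> \<in> T" "\<psi> \<in> T" "finite (subfamily \<F> \<phi>)" "finite (subfamily \<G> \<psi>)"
      by (auto simp: accumulation_points_def)
    have "subfamily (\<F> \<union> \<G>) (And \<phi> \<psi>) \<subseteq> subfamily \<F> \<phi> \<union> subfamily \<G> \<psi>"
      using assms by (auto simp: subfamily_def complete_theory_And[of \<Sigma>])
    then have "finite (subfamily (\<F> \<union> \<G>) (And \<phi> \<psi>))" using * finite_subset by blast
    then show False using T * by (auto simp: accumulation_points_def complete_theory_And[of \<Sigma>])
  qed
qed (simp add: accumulation_points_mono)

text \<open>A complete theory has at least one member, so the condition on its members is never
  vacuous.\<close>

lemma accumulation_points_empty: "accumulation_points \<Sigma> {} = {}"
proof -
  have "\<exists>\<phi>. \<phi> \<in> T" if T: "complete_theory \<Sigma> T" for T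
    using ex_true_sentence[of \<Sigma>] T by (auto simp: complete_theory_def)
  then show ?thesis by (auto simp: accumulation_points_def subfamily_def)
qed

lemma accumulation_points_UN:
  assumes "finite I" and "\<forall>i\<in>I. \<forall>T\<in>\<F> i. complete_theory \<Sigma> T"
  shows "accumulation_points \<Sigma> (\<Union>i\<in>I. \<F> i) = (\<Union>i\<in>I. accumulation_points \<Sigma> (\<F> i))"
  using assms
proof (induction I rule: finite_induct)
  case (insert i I)
  have "\<forall>T\<in>\<F> i \<union> (\<Union>i\<in>I. \<F> i). complete_theory \<Sigma> T" using insert.prems by auto
  from accumulation_points_Un[OF this] show ?case using insert by simp
qed (simp add: accumulation_points_empty)

text \<open>The theory of an ultraproduct of models of the members of \<F> is such a point: a
  sentence true in it holds on a set of indices in \<open>U\<close>, hence belongs to infinitely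
  many members of \<F>.\<close>

lemma accumulation_points_nonempty:
  fixes \<F> :: "'p form set set"
  assumes \<F>: "\<forall>T\<in>\<F>. complete_theory \<Sigma> T" and inf: "infinite \<F>"
  shows "accumulation_points \<Sigma> \<F> \<noteq> {}"
proof -
  obtain U :: "'p form set set set" where U:
    "\<And>A. - A \<in> U \<longleftrightarrow> A \<notin> U"
    "\<And>A B. A \<in> U \<Longrightarrow> B \<in> U \<Longrightarrow> A \<inter> B \<in> U"
    "\<And>A B. A \<in> U \<Longrightarrow> A \<subseteq> B \<Longrightarrow> B \<in> U"
    "\<And>A. A \<in> U \<Longrightarrow> infinite (\<F> \<inter> A)"
    using ex_free_ultrafilter[OF inf] by blast
  \<comment> \<open>The ultraproduct is indexed by all sets of formulas, so indices outside \<F>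
    also get some nonempty structure.\<close>
  have "\<exists>M :: ('p, 'p + nat) struct. univ M \<noteq> {} \<and>
      (T \<in> \<F> \<longrightarrow> (\<forall>\<phi>\<in>sentences \<Sigma>. \<phi> \<in> T \<longleftrightarrow> M \<Turnstile> \<phi>))" for T
  proof (cases "T \<in> \<F>")
    case True
    then show ?thesis using \<F> complete_theory_model by metis
  next
    case False
    then show ?thesis by (intro exI[of _ "\<lparr>univ = UNIV, interp = \<lambda>_ _. True\<rparr>"]) simp
  qed
  then obtain M :: "'p form set \<Rightarrow> ('p, 'p + nat) struct" where M: "\<And>T. univ (M T) \<noteq> {}"
    "\<And>T \<phi>. T \<in> \<F> \<Longrightarrow> \<phi> \<in> sentences \<Sigma> \<Longrightarrow> \<phi> \<in> T \<longleftrightarrow> M T \<Turnstile> \<phi>"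
    by metis
  obtain N :: "('p, 'p form set \<Rightarrow> 'p + nat) struct" where N: "univ N \<noteq> {}"
    "\<And>\<phi>. fv \<phi> = {} \<Longrightarrow> N \<Turnstile> \<phi> \<longleftrightarrow> {T. M T \<Turnstile> \<phi>} \<in> U"
    using ultraproduct[of U M] U(1-3) M(1) by metis
  define T where "T = {\<phi> \<in> sentences \<Sigma>. N \<Turnstile> \<phi>}"
  \<comment> \<open>\<open>N\<close> lives over a function type; the downward Loewenheim-Skolem
    theorem brings its theory back to the fixed universe type.\<close>
  have "model_of N T" using N(1) by (simp add: model_of_def T_def)
  then have "has_model T"
    by (rule has_model_if_model_of) (simp add: T_def sentences_def)
  then have "complete_theory \<Sigma> T"
    using models_Neg[OF N(1)] by (auto simp: complete_theory_def T_def)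
  moreover have "infinite (subfamily \<F> \<phi>)" if "\<phi> \<in> T" for \<phi>
  proof -
    have \<phi>: "\<phi> \<in> sentences \<Sigma>" "{T. M T \<Turnstile> \<phi>} \<in> U"
      using that N(2) by (auto simp: T_def sentences_def)
    have "\<F> \<inter> {T. M T \<Turnstile> \<phi>} = subfamily \<F> \<phi>"
      using M(2) \<phi>(1) by (auto simp: subfamily_def)
    then show ?thesis using U(4)[OF \<phi>(2)] by simp
  qed
  ultimately show ?thesis by (auto simp: accumulation_points_def)
qed

section \<open>Infinitely many inconsistent sentences met by an infinite family\<close>

text \<open>Two distinct members disagree on some sentence, so both halves are inhabited. One of
  them is infinite, and the sentence is negated if necessary to put that half first.\<close>

lemma infinite_family_split:
  assumes A: "\<forall>T\<in>A. complete_theory \<Sigma> T"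
    and \<chi>: "\<chi> \<in> sentences \<Sigma>" and inf: "infinite (subfamily A \<chi>)"
  shows "\<exists>\<theta>\<in>sentences \<Sigma>. infinite (subfamily A (And \<chi> \<theta>)) \<and> subfamily A (And \<chi> (Neg \<theta>)) \<noteq> {}"
proof -
  obtain T1 where T1: "T1 \<in> subfamily A \<chi>" using inf not_finite_existsD[of "\<lambda>T. T \<in> subfamily A \<chi>"] by auto
  obtain T2 where T2: "T2 \<in> subfamily A \<chi>" "T1 \<noteq> T2"
    using infinite_remove[OF inf, of T1] infinite_imp_nonempty by blast
  have c: "complete_theory \<Sigma> T1" "complete_theory \<Sigma> T2"
    using T1 T2 A by (auto simp: subfamily_def)
  have "\<exists>\<theta>\<in>sentences \<Sigma>. \<theta> \<in> T1 \<and> Neg \<theta> \<in> T2"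
  proof (cases "T1 \<subseteq> T2")
    case False
    then show ?thesis using c by (meson complete_theory_Neg complete_theory_subset subset_iff)
  next
    \<comment> \<open>Contradictory: \<open>Neg \<theta>\<close> lies in \<open>T1\<close>, hence in
      \<open>T2\<close> together with \<theta>.\<close>
    case True
    then obtain \<theta> where \<theta>: "\<theta> \<in> T2" "\<theta> \<notin> T1" using T2 by blast
    then have "\<theta> \<in> sentences \<Sigma>" using c complete_theory_subset by blast
    then show ?thesis using \<theta> c True by (metis complete_theory_Neg subsetD)
  qed
  then obtain \<theta> where \<theta>: "\<theta> \<in> sentences \<Sigma>" "\<theta> \<in> T1" "Neg \<theta> \<in> T2" by blast
  have ne: "T1 \<in> subfamily A (And \<chi> \<theta>)" "T2 \<in> subfamily A (And \<chi> (Neg \<theta>))"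
    using T1 T2 \<theta> c by (auto simp: subfamily_def complete_theory_And[of \<Sigma>])
  \<comment> \<open>Serves the case where the half of \<open>Neg \<theta>\<close> is the infinite
    one: the other half then carries a double negation.\<close>
  have nn: "subfamily A (And \<chi> (Neg (Neg \<theta>))) = subfamily A (And \<chi> \<theta>)"
    using A \<theta>(1) by (auto simp: subfamily_def complete_theory_And[of \<Sigma>] complete_theory_Neg[of \<Sigma>])
  have "subfamily A \<chi> \<subseteq> subfamily A (And \<chi> \<theta>) \<union> subfamily A (And \<chi> (Neg \<theta>))"
    using A \<theta>(1) by (auto simp: subfamily_def complete_theory_And[of \<Sigma>] complete_theory_Neg[of \<Sigma>])
  then have "infinite (subfamily A (And \<chi> \<theta>)) \<or> infinite (subfamily A (And \<chi> (Neg \<theta>)))"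
    using inf by (meson finite_UnI finite_subset)
  then show ?thesis
  proof
    assume "infinite (subfamily A (And \<chi> \<theta>))"
    then show ?thesis using ne \<theta>(1) by blast
  next
    assume "infinite (subfamily A (And \<chi> (Neg \<theta>)))"
    then show ?thesis using ne \<theta>(1) nn by (intro bexI[of _ "Neg \<theta>"]) auto
  qed
qed

text \<open>Repeated splitting gives a descending chain of sentences with infinite trace on
  \<open>A\<close>; the differences of consecutive terms are pairwise inconsistent, and
  \<open>A\<close> meets each of them.\<close>

lemma infinite_family_inconsistent_sentences:
  fixes A :: "'p form set set"
  assumes A: "\<forall>T\<in>A. complete_theory \<Sigma> T" and inf: "infinite A"
  shows "\<exists>\<psi> :: nat \<Rightarrow> 'p form. pairwise_inconsistent \<Sigma> UNIV \<psi> \<and> (\<forall>k. subfamily A (\<psi> k) \<noteq> {})"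
proof -
  define P where "P \<chi> \<longleftrightarrow> \<chi> \<in> sentences \<Sigma> \<and> infinite (subfamily A \<chi>)" for \<chi>
  define Q where "Q \<chi> \<chi>' \<longleftrightarrow> (\<forall>M :: ('p, 'p + nat) struct. M \<Turnstile> \<chi>' \<longrightarrow> M \<Turnstile> \<chi>) \<and>
    subfamily A (And \<chi> (Neg \<chi>')) \<noteq> {}" for \<chi> \<chi>'
  have "\<exists>f. \<forall>n::nat. P (f n) \<and> Q (f n) (f (Suc n))"
  proof (rule dependent_nat_choice)
    obtain \<phi> where \<phi>: "\<phi> \<in> sentences \<Sigma>" "\<And>M :: ('p, 'p + nat) struct. univ M \<noteq> {} \<Longrightarrow> M \<Turnstile> \<phi>"
      using ex_true_sentence[of \<Sigma>] by auto
    have "\<phi> \<in> T" if "T \<in> A" for T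
      using complete_theory_model[of \<Sigma> T] A \<phi> that by metis
    then have "subfamily A \<phi> = A" by (auto simp: subfamily_def)
    then show "\<exists>\<chi>. P \<chi>" using inf \<phi>(1) by (auto simp: P_def)
  next
    fix \<chi> and n :: nat assume \<chi>: "P \<chi>"
    then obtain \<theta> where \<theta>: "\<theta> \<in> sentences \<Sigma>" "infinite (subfamily A (And \<chi> \<theta>))"
      "subfamily A (And \<chi> (Neg \<theta>)) \<noteq> {}"
      using infinite_family_split[OF A] unfolding P_def by blast
    \<comment> \<open>The next term is \<open>And \<chi> \<theta>\<close>, so \<open>Q\<close>
      speaks of its negation rather than of \<open>Neg \<theta>\<close>.\<close>
    have "subfamily A (And \<chi> (Neg \<theta>)) \<subseteq> subfamily A (And \<chi> (Neg (And \<chi> \<theta>)))"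
      using A \<theta>(1) \<chi> by (auto simp: P_def subfamily_def complete_theory_And[of \<Sigma>] complete_theory_Neg[of \<Sigma>])
    then show "\<exists>\<chi>'. P \<chi>' \<and> Q \<chi> \<chi>'"
      using \<theta> \<chi> by (intro exI[of _ "And \<chi> \<theta>"]) (auto simp: P_def Q_def models_And)
  qed
  then obtain f where f: "\<And>n. P (f n)" "\<And>n. Q (f n) (f (Suc n))" by blast
  have mono: "M \<Turnstile> f i" if "M \<Turnstile> f j" "i \<le> j" for i j and M :: "('p, 'p + nat) struct"
    using that(2,1) by (induction rule: dec_induct) (use f(2) in \<open>auto simp: Q_def\<close>)
  define \<psi> where "\<psi> k = And (f k) (Neg (f (Suc k)))" for k
  have disj: "\<not> (M \<Turnstile> \<psi> i \<and> M \<Turnstile> \<psi> j)" if "univ M \<noteq> {}" "i < j" for i j and M :: "('p, 'p + nat) struct"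
  proof -
    have "f (Suc i) \<in> sentences \<Sigma>" using f(1) by (simp add: P_def)
    \<comment> \<open>The later difference implies \<open>f j\<close>, hence
      \<open>f (Suc i)\<close>, which the earlier one denies.\<close>
    then show ?thesis
      using mono[of M j "Suc i"] that by (auto simp: \<psi>_def models_And models_Neg)
  qed
  have "pairwise_inconsistent \<Sigma> UNIV \<psi>"
    unfolding pairwise_inconsistent_iff
  proof (intro conjI ballI impI allI)
    show "\<psi> i \<in> sentences \<Sigma>" for i using f(1) by (simp add: \<psi>_def P_def)
    show "\<not> (M \<Turnstile> \<psi> i \<and> M \<Turnstile> \<psi> j)" if "i \<noteq> j" "univ M \<noteq> {}" for i j and M :: "('p, 'p + nat) struct"
      using disj[OF that(2)] that(1) by (metis nat_neq_iff)
  qed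
  moreover have "subfamily A (\<psi> k) \<noteq> {}" for k using f(2)[of k] by (simp add: Q_def \<psi>_def)
  ultimately show ?thesis by blast
qed


section \<open>Rank and degree\<close>

lemma RS_ge_mono: "\<F> \<subseteq> \<G> \<Longrightarrow> RS_ge \<Sigma> \<alpha> \<F> \<Longrightarrow> RS_ge \<Sigma> \<alpha> \<G>"
proof (induction \<Sigma> \<alpha> \<F> arbitrary: \<G> rule: RS_ge.induct)
  case (3 \<Sigma> \<beta> \<F>)
  from "3.prems"(2) obtain \<phi> :: "nat \<Rightarrow> 'a form" where "pairwise_inconsistent \<Sigma> UNIV \<phi>"
    "\<forall>k. RS_ge \<Sigma> (Suc \<beta>) (subfamily \<F> (\<phi> k))" by auto
  then show ?case using subfamily_mono[OF "3.prems"(1)] "3.IH" by (subst RS_ge.simps(3)) blast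
qed (auto dest: finite_subset)

text \<open>The witnessing sentences serve one level lower; from level 2 to level 1 a single
  infinite subfamily suffices.\<close>

lemma RS_ge_SucD: "RS_ge \<Sigma> (Suc \<alpha>) \<F> \<Longrightarrow> RS_ge \<Sigma> \<alpha> \<F>"
proof (induction \<Sigma> \<alpha> \<F> rule: RS_ge.induct)
  case (2 \<Sigma> \<F>)
  then show ?case using subfamily_subset[of \<F>] by (auto dest: finite_subset)
next
  case (3 \<Sigma> \<beta> \<F>)
  from "3.prems" obtain \<phi> :: "nat \<Rightarrow> 'a form" where "pairwise_inconsistent \<Sigma> UNIV \<phi>"
    "\<forall>k. RS_ge \<Sigma> (Suc (Suc \<beta>)) (subfamily \<F> (\<phi> k))"
    by (subst (asm) RS_ge.simps(3)) blast
  then show ?case using "3.IH" by (subst RS_ge.simps(3)) blast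
qed auto

lemma RS_ge_antimono: "\<beta> \<le> \<alpha> \<Longrightarrow> RS_ge \<Sigma> \<alpha> \<F> \<Longrightarrow> RS_ge \<Sigma> \<beta> \<F>"
  by (induction rule: dec_induct) (auto dest: RS_ge_SucD)

lemma RS_eq_unique: "RS_eq \<Sigma> \<F> \<alpha> \<Longrightarrow> RS_eq \<Sigma> \<F> \<beta> \<Longrightarrow> \<alpha> = \<beta>"
  unfolding RS_eq_def by (metis RS_ge_antimono Suc_leI linorder_neqE_nat)

text \<open>Each infinite subfamily has an accumulation point containing its sentence, and
  inconsistency keeps these points apart. Conversely, an infinite derived set meets infinitely many
  inconsistent sentences, and a sentence in an accumulation point has an infinite subfamily.\<close>

lemma RS_ge_2_iff:
  assumes \<F>: "\<forall>T\<in>\<F>. complete_theory \<Sigma> T"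
  shows "RS_ge \<Sigma> 2 \<F> \<longleftrightarrow> infinite (accumulation_points \<Sigma> \<F>)"
proof
  assume "RS_ge \<Sigma> 2 \<F>"
  then obtain \<phi> :: "nat \<Rightarrow> _" where \<phi>: "pairwise_inconsistent \<Sigma> UNIV \<phi>"
    "\<And>k. infinite (subfamily \<F> (\<phi> k))"
    by (auto simp: numeral_2_eq_2)
  have "\<exists>T. T \<in> accumulation_points \<Sigma> \<F> \<and> \<phi> k \<in> T" for k
  proof -
    have "accumulation_points \<Sigma> (subfamily \<F> (\<phi> k)) \<noteq> {}"
      using \<F> \<phi>(2) by (intro accumulation_points_nonempty) (auto simp: subfamily_def)
    moreover have "\<phi> k \<in> sentences \<Sigma>" using \<phi>(1) by (simp add: pairwise_inconsistent_def)
    ultimately show ?thesis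
      using accumulation_points_subfamily[OF \<F>] by (auto simp: subfamily_def)
  qed
  then obtain t where t: "\<And>k. t k \<in> accumulation_points \<Sigma> \<F>" "\<And>k. \<phi> k \<in> t k" by metis
  have "inj t"
  proof (rule injI)
    fix k l assume "t k = t l"
    then have "\<phi> k \<in> t k" "\<phi> l \<in> t k" using t(2) by metis+
    moreover have "complete_theory \<Sigma> (t k)" using t(1) accumulation_points_complete by blast
    ultimately show "k = l" using complete_theory_inconsistent[OF \<phi>(1)] by blast
  qed
  then show "infinite (accumulation_points \<Sigma> \<F>)"
    using t(1) by (meson infinite_iff_countable_subset image_subsetI)
next
  assume "infinite (accumulation_points \<Sigma> \<F>)"
  from infinite_family_inconsistent_sentences[OF accumulation_points_complete this]
  obtain \<psi> :: "nat \<Rightarrow> _" where \<psi>: "pairwise_inconsistent \<Sigma> UNIV \<psi>"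
    "\<And>k. subfamily (accumulation_points \<Sigma> \<F>) (\<psi> k) \<noteq> {}" by blast
  have "infinite (subfamily \<F> (\<psi> k))" for k
    using \<psi>(2)[of k] by (auto simp: subfamily_def accumulation_points_def)
  then show "RS_ge \<Sigma> 2 \<F>" using \<psi>(1) by (auto simp: numeral_2_eq_2)
qed

lemma RS_ge_3_iff:
  assumes \<F>: "\<forall>T\<in>\<F>. complete_theory \<Sigma> T"
  shows "RS_ge \<Sigma> (Suc 2) \<F> \<longleftrightarrow> (\<exists>\<phi> :: nat \<Rightarrow> _. pairwise_inconsistent \<Sigma> UNIV \<phi> \<and>
    (\<forall>k. infinite (subfamily (accumulation_points \<Sigma> \<F>) (\<phi> k))))"
proof -
  have "RS_ge \<Sigma> 2 (subfamily \<F> (\<phi> k)) \<longleftrightarrow>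
      infinite (subfamily (accumulation_points \<Sigma> \<F>) (\<phi> k))"
    if "pairwise_inconsistent \<Sigma> UNIV \<phi>" for \<phi> and k :: nat
  proof -
    have "\<phi> k \<in> sentences \<Sigma>" using that by (simp add: pairwise_inconsistent_def)
    then show ?thesis
      using \<F> RS_ge_2_iff[of "subfamily \<F> (\<phi> k)"] accumulation_points_subfamily[OF \<F>]
      by (simp add: subfamily_def)
  qed
  moreover have "RS_ge \<Sigma> (Suc 2) \<F> \<longleftrightarrow> (\<exists>\<phi> :: nat \<Rightarrow> _. pairwise_inconsistent \<Sigma> UNIV \<phi> \<and>
      (\<forall>k. RS_ge \<Sigma> 2 (subfamily \<F> (\<phi> k))))"
    unfolding numeral_2_eq_2 by (rule RS_ge.simps(3))
  ultimately show ?thesis by blast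
qed

section \<open>Minimal pieces and the derived set\<close>

text \<open>Expresses minimality of a piece through the derived set of the whole family; nested cuts
  become conjunctions.\<close>

lemma a_minimal_subfamily_iff:
  assumes \<F>: "\<forall>T\<in>\<F>. complete_theory \<Sigma> T" and \<phi>: "\<phi> \<in> sentences \<Sigma>"
  shows "a_minimal \<Sigma> (subfamily \<F> \<phi>) \<longleftrightarrow>
    infinite (subfamily (accumulation_points \<Sigma> \<F>) \<phi>) \<and>
    (\<forall>\<theta>\<in>sentences \<Sigma>. finite (subfamily (accumulation_points \<Sigma> \<F>) (And \<phi> \<theta>)) \<or>
                      finite (subfamily (accumulation_points \<Sigma> \<F>) (And \<phi> (Neg \<theta>))))"
proof -
  have "\<forall>T\<in>subfamily \<F> \<phi>. complete_theory \<Sigma> T" using \<F> by (simp add: subfamily_def)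
  note sub = accumulation_points_subfamily[OF this]
  show ?thesis
    unfolding a_minimal_def
    by (simp add: sub accumulation_points_subfamily[OF \<F> \<phi>]
        subfamily_And[OF accumulation_points_complete])
qed

text \<open>Each \<open>\<psi> k\<close> picks a piece that it meets infinitely often; by minimality no piece is picked twice.\<close>

lemma card_le_of_minimal_partition:
  assumes A: "\<forall>T\<in>A. complete_theory \<Sigma> T"
    and J: "finite J" "A = (\<Union>j\<in>J. subfamily A (\<phi> j))"
    and min: "\<forall>j\<in>J. \<forall>\<theta>\<in>sentences \<Sigma>. finite (subfamily A (And (\<phi> j) \<theta>)) \<or>
                                         finite (subfamily A (And (\<phi> j) (Neg \<theta>)))"
    and \<psi>: "pairwise_inconsistent \<Sigma> K \<psi>" "\<forall>k\<in>K. infinite (subfamily A (\<psi> k))"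
  shows "finite K \<and> card K \<le> card J"
proof -
  have "\<exists>j\<in>J. infinite (subfamily A (And (\<phi> j) (\<psi> k)))" if "k \<in> K" for k
  proof (rule ccontr)
    assume "\<not> ?thesis"
    \<comment> \<open>The pieces cover \<open>A\<close>, so finite shares in all of them would make
      the trace of \<open>\<psi> k\<close> finite.\<close>
    then have "finite (\<Union>j\<in>J. subfamily A (And (\<phi> j) (\<psi> k)))" using J(1) by blast
    moreover have "subfamily A (\<psi> k) \<subseteq> (\<Union>j\<in>J. subfamily A (And (\<phi> j) (\<psi> k)))"
    proof
      fix T assume T: "T \<in> subfamily A (\<psi> k)"
      then have "T \<in> A" "\<psi> k \<in> T" by (auto simp: subfamily_def)
      moreover obtain j where "j \<in> J" "\<phi> j \<in> T"
        using \<open>T \<in> A\<close> J(2) by (auto simp: subfamily_def)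
      ultimately have "T \<in> subfamily A (And (\<phi> j) (\<psi> k))"
        using A by (simp add: subfamily_def complete_theory_And[of \<Sigma>])
      then show "T \<in> (\<Union>j\<in>J. subfamily A (And (\<phi> j) (\<psi> k)))"
        using \<open>j \<in> J\<close> by blast
    qed
    ultimately show False using \<psi>(2) that finite_subset by blast
  qed
  then obtain h where h: "\<And>k. k \<in> K \<Longrightarrow> h k \<in> J"
    "\<And>k. k \<in> K \<Longrightarrow> infinite (subfamily A (And (\<phi> (h k)) (\<psi> k)))" by metis
  have "inj_on h K"
  proof (rule inj_onI, rule ccontr)
    fix k l assume kl: "k \<in> K" "l \<in> K" "h k = h l" "k \<noteq> l"
    have s: "\<psi> k \<in> sentences \<Sigma>" using \<psi>(1) kl by (simp add: pairwise_inconsistent_def)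
    \<comment> \<open>A theory with \<open>\<psi> l\<close> omits \<open>\<psi> k\<close>; if
      \<open>k\<close> and \<open>l\<close> picked the same piece, \<open>\<psi> k\<close> would cut
      it into two infinite parts.\<close>
    have "subfamily A (And (\<phi> (h l)) (\<psi> l)) \<subseteq> subfamily A (And (\<phi> (h k)) (Neg (\<psi> k)))"
    proof
      fix T assume "T \<in> subfamily A (And (\<phi> (h l)) (\<psi> l))"
      then have T: "T \<in> A" "complete_theory \<Sigma> T" "\<phi> (h l) \<in> T" "\<psi> l \<in> T"
        using A by (auto simp: subfamily_def complete_theory_And[of \<Sigma>])
      then have "\<psi> k \<notin> T" using complete_theory_inconsistent[OF \<psi>(1)] kl by metis
      then show "T \<in> subfamily A (And (\<phi> (h k)) (Neg (\<psi> k)))"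
        using T kl(3) s by (simp add: subfamily_def complete_theory_And[of \<Sigma>] complete_theory_Neg[of \<Sigma>])
    qed
    then have "infinite (subfamily A (And (\<phi> (h k)) (Neg (\<psi> k))))"
      using h(2)[OF kl(2)] finite_subset by blast
    then show False using min h kl(1) s by blast
  qed
  moreover have "h ` K \<subseteq> J" using h(1) by blast
  ultimately show ?thesis using J(1) by (meson card_inj_on_le inj_on_finite)
qed

text \<open>Raises the number of inconsistent sentences by one: \<theta> cuts
  \<open>\<phi> i\<close> in two, one half stays at \<open>i\<close>, the other takes the fresh
  index \<open>m\<close>.\<close>

lemma pairwise_inconsistent_split:
  assumes \<phi>: "pairwise_inconsistent \<Sigma> I \<phi>" and "i \<in> I" "m \<notin> I" and \<theta>: "\<theta> \<in> sentences \<Sigma>"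
  shows "pairwise_inconsistent \<Sigma> (insert m I)
           (\<phi>(i := And (\<phi> i) \<theta>, m := And (\<phi> i) (Neg \<theta>)))"
proof -
  let ?\<psi> = "\<phi>(i := And (\<phi> i) \<theta>, m := And (\<phi> i) (Neg \<theta>))"
  have s: "\<forall>j\<in>I. \<phi> j \<in> sentences \<Sigma>" using \<phi> by (simp add: pairwise_inconsistent_def)
  have "\<not> (M \<Turnstile> ?\<psi> j \<and> M \<Turnstile> ?\<psi> k)"
    if M: "univ M \<noteq> {}" and jk: "j \<in> insert m I" "k \<in> insert m I" "j \<noteq> k"
    for j k and M :: "('a, 'a + nat) struct"
  proof
    assume *: "M \<Turnstile> ?\<psi> j \<and> M \<Turnstile> ?\<psi> k"
    \<comment> \<open>\<open>r\<close> sends an index to the original sentence it comes from. Two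
      indices true in one structure have the same origin, so they are the two halves, which disagree
      on \<theta>.\<close>
    define r where "r l = (if l = m then i else l)" for l
    have r: "r l \<in> I" "M \<Turnstile> \<phi> (r l)" if "l \<in> insert m I" "M \<Turnstile> ?\<psi> l" for l
      using that \<open>i \<in> I\<close> by (auto simp: r_def models_And split: if_splits)
    have "r j = r k"
      using \<phi> M r[of j] r[of k] jk * unfolding pairwise_inconsistent_iff by blast
    then have "(j = i \<and> k = m) \<or> (j = m \<and> k = i)"
      using jk(3) by (auto simp: r_def split: if_splits)
    then show False
      using * \<open>i \<in> I\<close> \<open>m \<notin> I\<close> models_Neg[OF M \<theta>]
      by (auto simp: models_And split: if_splits)
  qed
  moreover have "\<forall>j\<in>insert m I. ?\<psi> j \<in> sentences \<Sigma>" using s \<theta> \<open>i \<in> I\<close> by simp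
  ultimately show ?thesis unfolding pairwise_inconsistent_iff by blast
qed

section \<open>The degree of a family of rank 2\<close>

text \<open>A subfamily inherits the upper bound on the rank, so only the lower bound has to be
  tested, and that is infinity of its derived set.\<close>

lemma RS_eq_2_subfamily:
  assumes \<F>: "\<forall>T\<in>\<F>. complete_theory \<Sigma> T" and rank: "RS_eq \<Sigma> \<F> 2" and \<phi>: "\<phi> \<in> sentences \<Sigma>"
  shows "RS_eq \<Sigma> (subfamily \<F> \<phi>) 2 \<longleftrightarrow> infinite (subfamily (accumulation_points \<Sigma> \<F>) \<phi>)"
proof -
  have "\<not> RS_ge \<Sigma> (Suc 2) (subfamily \<F> \<phi>)"
    using rank RS_ge_mono[OF subfamily_subset] by (auto simp: RS_eq_def)
  moreover have "\<forall>T\<in>subfamily \<F> \<phi>. complete_theory \<Sigma> T" using \<F> by (simp add: subfamily_def)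
  ultimately show ?thesis
    using RS_ge_2_iff[of "subfamily \<F> \<phi>" \<Sigma>] accumulation_points_subfamily[OF \<F> \<phi>]
    by (simp add: RS_eq_def)
qed

text \<open>The rank quantified inside \<open>ds_eq\<close> is forced to be 2; rank 2 of the pieces
  then translates into infinite traces on the derived set.\<close>

lemma ds_eq_2_iff:
  assumes \<F>: "\<forall>T\<in>\<F>. complete_theory \<Sigma> T" and rank: "RS_eq \<Sigma> \<F> 2"
  shows "ds_eq \<Sigma> \<F> n \<longleftrightarrow>
    (\<exists>\<phi>. pairwise_inconsistent \<Sigma> {1..n} \<phi> \<and>
         (\<forall>i\<in>{1..n}. infinite (subfamily (accumulation_points \<Sigma> \<F>) (\<phi> i)))) \<and>
    (\<forall>m \<phi>. pairwise_inconsistent \<Sigma> {1..m} \<phi> \<longrightarrow>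
         (\<forall>i\<in>{1..m}. infinite (subfamily (accumulation_points \<Sigma> \<F>) (\<phi> i))) \<longrightarrow> m \<le> n)"
proof -
  have *: "(pairwise_inconsistent \<Sigma> {1..m} \<phi> \<and> (\<forall>i\<in>{1..m}. RS_eq \<Sigma> (subfamily \<F> (\<phi> i)) 2)) \<longleftrightarrow>
    (pairwise_inconsistent \<Sigma> {1..m} \<phi> \<and>
      (\<forall>i\<in>{1..m}. infinite (subfamily (accumulation_points \<Sigma> \<F>) (\<phi> i))))" for m and \<phi> :: "nat \<Rightarrow> _"
    using RS_eq_2_subfamily[OF \<F> rank] by (auto simp: pairwise_inconsistent_def)
  have "RS_eq \<Sigma> \<F> \<alpha> \<longleftrightarrow> \<alpha> = 2" for \<alpha> using rank RS_eq_unique by blast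
  then show ?thesis unfolding ds_eq_def Let_def by (simp only: simp_thms * mem_Collect_eq) blast
qed

text \<open>
  Sentences witnessing the degree need not cover the family, so one of them is replaced by the
  negation of the disjunction of the others.
\<close>

lemma pairwise_inconsistent_cover:
  fixes \<phi> :: "'i \<Rightarrow> 'p form"
  assumes \<phi>: "pairwise_inconsistent \<Sigma> I \<phi>" and "finite I" "i \<in> I"
  obtains \<psi> where "pairwise_inconsistent \<Sigma> I \<psi>"
    and "\<And>T. complete_theory \<Sigma> T \<Longrightarrow> \<exists>j\<in>I. \<psi> j \<in> T"
    and "\<And>T j. complete_theory \<Sigma> T \<Longrightarrow> j \<in> I \<Longrightarrow> \<phi> j \<in> T \<Longrightarrow> \<psi> j \<in> T"
proof -
  have s: "\<forall>j\<in>I. \<phi> j \<in> sentences \<Sigma>" using \<phi> by (simp add: pairwise_inconsistent_def)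
  obtain \<chi> where \<chi>: "\<chi> \<in> sentences \<Sigma>" "\<And>M :: ('p, 'p + nat) struct. univ M \<noteq> {} \<Longrightarrow>
      M \<Turnstile> \<chi> \<longleftrightarrow> (\<forall>j\<in>I - {i}. \<not> M \<Turnstile> \<phi> j)"
    using ex_conj_neg_sentence[of "I - {i}" \<phi> \<Sigma>] s \<open>finite I\<close> by auto
  have \<chi>T: "\<chi> \<in> T \<longleftrightarrow> (\<forall>j\<in>I - {i}. \<phi> j \<notin> T)" if "complete_theory \<Sigma> T" for T
    using complete_theory_model[OF that] \<chi> s by (metis DiffD1)
  show ?thesis
  proof (rule that[of "\<phi>(i := \<chi>)"])
    show "pairwise_inconsistent \<Sigma> I (\<phi>(i := \<chi>))"
      using \<phi> \<chi> unfolding pairwise_inconsistent_iff by auto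
    show "\<exists>j\<in>I. (\<phi>(i := \<chi>)) j \<in> T" if "complete_theory \<Sigma> T" for T
      using \<chi>T[OF that] \<open>i \<in> I\<close> by auto
    \<comment> \<open>At index \<open>i\<close> the old sentence excludes all the others and so
      implies \<chi>; hence no infinite trace is lost.\<close>
    show "(\<phi>(i := \<chi>)) j \<in> T" if "complete_theory \<Sigma> T" "j \<in> I" "\<phi> j \<in> T" for T j
      using \<chi>T[OF that(1)] complete_theory_inconsistent[OF \<phi> that(1)] that by auto
  qed
qed

section \<open>Rank 2 and degree n as a decomposition into minimal pieces\<close>

theorem theorem2p12:
  fixes \<Sigma> :: "'p lang" and \<T> :: "'p form set set" and n :: nat
  assumes "\<forall>T\<in>\<T>. complete_theory \<Sigma> T" and "n > 0"
  shows "RS_eq \<Sigma> \<T> 2 \<and> ds_eq \<Sigma> \<T> n \<longleftrightarrow>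
    (\<exists>\<phi> :: nat \<Rightarrow> 'p form.
       pairwise_inconsistent \<Sigma> {1..n} \<phi> \<and>
       \<T> = (\<Union>i\<in>{1..n}. subfamily \<T> (\<phi> i)) \<and>
       disjoint_family_on (\<lambda>i. subfamily \<T> (\<phi> i)) {1..n} \<and>
       (\<forall>i\<in>{1..n}. a_minimal \<Sigma> (subfamily \<T> (\<phi> i))))"
    (is "?lhs \<longleftrightarrow> ?rhs")
proof
  define A where "A = accumulation_points \<Sigma> \<T>"
  have A: "\<forall>T\<in>A. complete_theory \<Sigma> T" unfolding A_def by (rule accumulation_points_complete)
  assume ?lhs
  then have rank: "RS_eq \<Sigma> \<T> 2" and "ds_eq \<Sigma> \<T> n" by auto
  from \<open>ds_eq \<Sigma> \<T> n\<close> obtain \<phi> :: "nat \<Rightarrow> 'p form" where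
      \<phi>: "pairwise_inconsistent \<Sigma> {1..n} \<phi>" "\<forall>i\<in>{1..n}. infinite (subfamily A (\<phi> i))" and
      max: "\<And>m \<phi>. pairwise_inconsistent \<Sigma> {1..m} \<phi> \<Longrightarrow>
        \<forall>i\<in>{1..m}. infinite (subfamily A (\<phi> i)) \<Longrightarrow> m \<le> n"
    unfolding ds_eq_2_iff[OF assms(1) rank] A_def by blast
  \<comment> \<open>The sentence at index 1, present because \<open>n > 0\<close>, is enlarged so
    that the pieces cover \<T>.\<close>
  obtain \<psi> where \<psi>: "pairwise_inconsistent \<Sigma> {1..n} \<psi>"
      "\<And>T. complete_theory \<Sigma> T \<Longrightarrow> \<exists>j\<in>{1..n}. \<psi> j \<in> T"
      "\<And>T j. complete_theory \<Sigma> T \<Longrightarrow> j \<in> {1..n} \<Longrightarrow> \<phi> j \<in> T \<Longrightarrow> \<psi> j \<in> T"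
    using pairwise_inconsistent_cover[OF \<phi>(1), of 1] \<open>n > 0\<close> by auto
  have inf: "infinite (subfamily A (\<psi> i))" if "i \<in> {1..n}" for i
  proof -
    have "subfamily A (\<phi> i) \<subseteq> subfamily A (\<psi> i)"
      using \<psi>(3) A that by (auto simp: subfamily_def)
    then show ?thesis using \<phi>(2) that finite_subset by blast
  qed
  have "a_minimal \<Sigma> (subfamily \<T> (\<psi> i))" if i: "i \<in> {1..n}" for i
  proof -
    have s: "\<psi> i \<in> sentences \<Sigma>" using \<psi>(1) i by (simp add: pairwise_inconsistent_def)
    have "finite (subfamily A (And (\<psi> i) \<theta>)) \<or> finite (subfamily A (And (\<psi> i) (Neg \<theta>)))"
      if \<theta>: "\<theta> \<in> sentences \<Sigma>" for \<theta>
    proof (rule ccontr)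
      assume neg: "\<not> ?thesis"
      \<comment> \<open>Cutting one piece into two infinite parts would give \<open>n + 1\<close>
        sentences with infinite traces, against the maximality of \<open>n\<close>.\<close>
      define \<psi>' where "\<psi>' = \<psi>(i := And (\<psi> i) \<theta>, Suc n := And (\<psi> i) (Neg \<theta>))"
      have "{1..Suc n} = insert (Suc n) {1..n}" by auto
      then have "pairwise_inconsistent \<Sigma> {1..Suc n} \<psi>'"
        unfolding \<psi>'_def using pairwise_inconsistent_split[OF \<psi>(1) i _ \<theta>, of "Suc n"] by simp
      moreover have "\<forall>j\<in>{1..Suc n}. infinite (subfamily A (\<psi>' j))"
        using neg inf by (auto simp: \<psi>'_def le_Suc_eq)
      ultimately show False using max by fastforce
    qed
    then show ?thesis
      unfolding a_minimal_subfamily_iff[OF assms(1) s] A_def[symmetric] using inf[OF i] by blast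
  qed
  moreover have "\<T> = (\<Union>i\<in>{1..n}. subfamily \<T> (\<psi> i))"
    using \<psi>(2) assms(1) by (auto simp: subfamily_def)
  moreover have "disjoint_family_on (\<lambda>i. subfamily \<T> (\<psi> i)) {1..n}"
    using complete_theory_inconsistent[OF \<psi>(1)] assms(1)
    by (auto simp: disjoint_family_on_def subfamily_def)
  ultimately show ?rhs using \<psi>(1) by blast
next
  define A where "A = accumulation_points \<Sigma> \<T>"
  have A: "\<forall>T\<in>A. complete_theory \<Sigma> T" unfolding A_def by (rule accumulation_points_complete)
  assume ?rhs
  then obtain \<phi> :: "nat \<Rightarrow> 'p form" where \<phi>: "pairwise_inconsistent \<Sigma> {1..n} \<phi>"
    "\<T> = (\<Union>i\<in>{1..n}. subfamily \<T> (\<phi> i))"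
    and min: "\<forall>i\<in>{1..n}. a_minimal \<Sigma> (subfamily \<T> (\<phi> i))" by blast
  have s: "\<phi> i \<in> sentences \<Sigma>" if "i \<in> {1..n}" for i
    using \<phi>(1) that by (simp add: pairwise_inconsistent_def)
  have inf: "\<forall>i\<in>{1..n}. infinite (subfamily A (\<phi> i))"
    and split: "\<forall>i\<in>{1..n}. \<forall>\<theta>\<in>sentences \<Sigma>. finite (subfamily A (And (\<phi> i) \<theta>)) \<or>
      finite (subfamily A (And (\<phi> i) (Neg \<theta>)))"
    using min a_minimal_subfamily_iff[OF assms(1) s] unfolding A_def by blast+
  \<comment> \<open>Deriving commutes with the finite union and with each cut, so the decomposition
    of \<T> induces a cover of its derived set.\<close>
  have "A = accumulation_points \<Sigma> (\<Union>i\<in>{1..n}. subfamily \<T> (\<phi> i))"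
    using \<phi>(2) by (simp add: A_def)
  also have "\<dots> = (\<Union>i\<in>{1..n}. subfamily A (\<phi> i))"
  proof -
    have "\<forall>i\<in>{1..n}. \<forall>T\<in>subfamily \<T> (\<phi> i). complete_theory \<Sigma> T"
      using assms(1) by (simp add: subfamily_def)
    from accumulation_points_UN[OF finite_atLeastAtMost this] show ?thesis
      using accumulation_points_subfamily[OF assms(1) s] by (simp add: A_def)
  qed
  finally have cover: "A = (\<Union>i\<in>{1..n}. subfamily A (\<phi> i))" .
  \<comment> \<open>\<open>K\<close> is arbitrary: \<open>UNIV\<close> refutes rank at least 3, and
    \<open>{1..m}\<close> bounds the degree.\<close>
  have bound: "finite K \<and> card K \<le> n"
    if "pairwise_inconsistent \<Sigma> K \<psi>" "\<forall>k\<in>K. infinite (subfamily A (\<psi> k))"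
    for K :: "nat set" and \<psi>
    using card_le_of_minimal_partition[OF A finite_atLeastAtMost cover split that] by simp
  \<comment> \<open>Since \<open>n > 0\<close>, the piece of \<open>\<phi> 1\<close> already makes
    the derived set infinite.\<close>
  have "RS_ge \<Sigma> 2 \<T>"
    unfolding RS_ge_2_iff[OF assms(1)] A_def[symmetric]
    using inf \<open>n > 0\<close> finite_subset[OF subfamily_subset, of A "\<phi> 1"] by auto
  moreover have "\<not> RS_ge \<Sigma> (Suc 2) \<T>"
    unfolding RS_ge_3_iff[OF assms(1)] A_def[symmetric] using bound[of UNIV] by auto
  ultimately have rank: "RS_eq \<Sigma> \<T> 2" by (simp add: RS_eq_def)
  moreover have "ds_eq \<Sigma> \<T> n"
    unfolding ds_eq_2_iff[OF assms(1) rank] A_def[symmetric]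
    using \<phi>(1) inf bound by fastforce
  ultimately show ?lhs by blast
qed

end
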